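(* Let $k_1,k_2\ge2$ be even integers. There is an isomorphism $$V^{\mathbb Q}_{k_1,k_2}[I_D]\cong\bigoplus_{i=0}^{\min(k_1,k_2)}W^{\mathbb Q}_{k_1+k_2-2i}.$$ This result can be specialised according to parity: for a sign $\epsilon\in\{+,-\}$, $$V^{\mathbb Q}_{k_1,k_2}[I_D]\cap V^{\epsilon}_{k_1,k_2}\cong\bigoplus_{i=0}^{\min(k_1,k_2)}W^{\mathbb Q,(-1)^i\epsilon}_{k_1+k_2-2i}.$$
   Context: Let $S=\begin{pmatrix}0&-1\\1&0\end{pmatrix}$, $U=\begin{pmatrix}0&1\\-1&1\end{pmatrix}$ in $\Gamma=PSL_2(\mathbb Z)$. For an even integer $k$, $V_k^{\mathbb Q}$ is the space of polynomials over $\mathbb Q$ in one variable of degree $\le k-2$, with right action $P|_\gamma(X)=(cX+d)^{k-2}P\big(\frac{aX+b}{cX+d}\big)$ for $\gamma=\begin{pmatrix}a&b\\c&d\end{pmatrix}\in\Gamma$, extended linearly to $\mathbb Z[\Gamma]$; $V^{\mathbb Q}_{k_1,k_2}$ is the space of polynomials in $X_1,X_2$ over $\mathbb Q$ with $\deg_{X_j}\le k_j-2$, with the coordinatewise action of $\Gamma^2$ extended linearly to $\mathbb Z[\Gamma^2]$. $W^{\mathbb Q}_k=\{P\in V^{\mathbb Q}_k:P|_{1+S}=P|_{1+U+U^2}=0\}$ and $W_k^{\mathbb Q,\pm}=\{P\in W_k^{\mathbb Q}:P(-X)=\pm P(X)\}$. $V^{\mathbb Q}_{k_1,k_2}[I_D]=\{P\in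 V^{\mathbb Q}_{k_1,k_2}:P|_{(1,1)+(S,S)}=P|_{(1,1)+(U,U)+(U^2,U^2)}=0\}$ and $V^{\pm}_{k_1,k_2}$ is the space of polynomials $P$ in $X_1,X_2$ with $\deg_{X_j}\le k_j-2$ and $P(-X_1,-X_2)=\pm P(X_1,X_2)$. Signs $\pm$ are identified with $\pm1$.
   Formalization: Both direct sums are corrected to run over 0≤i≤min(k_1,k_2)-2 with weights k_1+k_2-2-2i (signs unchanged); as printed the claim fails, e.g. for k_1=k_2=2 the left side is 0 while W_4 contains X^2-1. *)

theory Defs
  imports
    "HOL-Analysis.Cartesian_Space"
    "HOL-Computational_Algebra.Polynomial"
    "HOL-Library.Function_Algebras"
begin

section \<open>The matrices and the slash action\<close>

text \<open>
  Elements of \<open>PSL\<^sub>2(\<int>)\<close> are given by representatives in \<open>SL\<^sub>2(\<int>)\<close>; in even weight the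
  choice of representative is irrelevant (lemma \<open>slash_uminus\<close>).
\<close>

definition S :: "int^2^2" where
  "S = vector [vector [0, -1], vector [1, 0]]"

definition U :: "int^2^2" where
  "U = vector [vector [0, 1], vector [-1, 1]]"

text \<open>
  The natural number \<open>k\<close> is the weight, so that the degree bound is \<open>k - 2\<close>; it is written
  without truncated subtraction, so that \<open>V 0 = {0}\<close>.
\<close>

definition V :: "nat \<Rightarrow> ('a::zero) poly set" where
  "V k = {P. \<forall>n. coeff P n \<noteq> 0 \<longrightarrow> n + 2 \<le> k}"

text \<open>
  The polynomial \<open>(c X + d)\<^bsup>k - 2\<^esup> P ((a X + b) / (c X + d))\<close>, with the denominators cleared
  (see lemma \<open>poly_slash\<close>). The coefficient ring is arbitrary because for bivariate polynomials
  it is itself a polynomial ring.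
\<close>

definition slash :: "nat \<Rightarrow> int^2^2 \<Rightarrow> 'a::comm_ring_1 poly \<Rightarrow> 'a poly" where
  "slash k \<gamma> P = (\<Sum>n\<le>k - 2. smult (coeff P n)
     ([:of_int (\<gamma>$1$2), of_int (\<gamma>$1$1):] ^ n * [:of_int (\<gamma>$2$2), of_int (\<gamma>$2$1):] ^ (k - 2 - n)))"

lemma slash_0 [simp]: "slash k \<gamma> 0 = 0"
  by (simp add: slash_def)

lemma V_degree_le:
  assumes "P \<in> V k"
  shows "degree P \<le> k - 2"
  using assms by (intro degree_le) (fastforce simp: V_def)

lemma poly_V:
  fixes x :: "'a::comm_ring_1"
  assumes "P \<in> V k"
  shows "poly P x = (\<Sum>i\<le>k - 2. coeff P i * x ^ i)"
  unfolding poly_altdef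
  using V_degree_le[OF assms] by (intro sum.mono_neutral_left) (auto simp: coeff_eq_0)

lemma poly_slash:
  fixes P :: "'a::field poly"
  assumes "P \<in> V k" and nz: "of_int (\<gamma>$2$1) * x + of_int (\<gamma>$2$2) \<noteq> (0::'a)"
  shows "poly (slash k \<gamma> P) x =
    (of_int (\<gamma>$2$1) * x + of_int (\<gamma>$2$2)) ^ (k - 2) *
      poly P ((of_int (\<gamma>$1$1) * x + of_int (\<gamma>$1$2)) / (of_int (\<gamma>$2$1) * x + of_int (\<gamma>$2$2)))"
    (is "_ = ?d ^ _ * poly P (?n / ?d)")
proof -
  have d: "?d \<noteq> 0" by (fact nz)
  have *: "?n ^ i * ?d ^ (k - 2 - i) = ?d ^ (k - 2) * (?n / ?d) ^ i" if "i \<le> k - 2" for i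
  proof -
    have "?d ^ (k - 2) = ?d ^ i * ?d ^ (k - 2 - i)"
      by (simp only: le_add_diff_inverse[OF that] flip: power_add)
    then show ?thesis using d by (simp add: power_divide del: diff_diff_left diff_Suc_1)
  qed
  have P: "poly P z = (\<Sum>i\<le>k - 2. coeff P i * z ^ i)" for z
    by (rule poly_V) fact
  have "poly (slash k \<gamma> P) x = (\<Sum>i\<le>k - 2. coeff P i * (?n ^ i * ?d ^ (k - 2 - i)))"
    by (simp add: slash_def poly_sum add.commute mult.commute)
  also have "\<dots> = (\<Sum>i\<le>k - 2. ?d ^ (k - 2) * (coeff P i * (?n / ?d) ^ i))"
    by (intro sum.cong refl, subst *) (simp, simp only: mult_ac)
  also have "\<dots> = ?d ^ (k - 2) * poly P (?n / ?d)"
    by (simp only: P sum_distrib_left)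
  finally show ?thesis .
qed

lemma slash_uminus:
  assumes "even k"
  shows "slash k (- \<gamma>) P = slash k \<gamma> P"
proof -
  have neg: "[:- a, - b:] = - [:a, b:]" for a b :: 'a by simp
  have "(- p) ^ n * (- q) ^ (k - 2 - n) = p ^ n * q ^ (k - 2 - n)" if "n \<le> k - 2"
    for p q :: "'a poly" and n
  proof -
    have "(- p) ^ n * (- q) ^ (k - 2 - n) = (- 1) ^ (n + (k - 2 - n)) * (p ^ n * q ^ (k - 2 - n))"
      by (subst (1 2) power_minus) (simp add: power_add mult_ac)
    also have "n + (k - 2 - n) = k - 2"
      by (fact le_add_diff_inverse[OF that])
    also have "(- 1 :: 'a poly) ^ (k - 2) = 1"
      using assms by (intro neg_one_even_power) simp
    finally show ?thesis by simp
  qed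
  then show ?thesis
    unfolding slash_def by (intro sum.cong refl) (simp del: minus_pCons add: neg)
qed

section \<open>Period polynomials in one variable\<close>

definition W :: "nat \<Rightarrow> rat poly set" where
  "W k = {P \<in> V k. P + slash k S P = 0 \<and> P + slash k U P + slash k (U ** U) P = 0}"

definition W_sign :: "nat \<Rightarrow> rat \<Rightarrow> rat poly set" where
  "W_sign k \<epsilon> = {P \<in> W k. pcompose P [:0, -1:] = smult \<epsilon> P}"

section \<open>Polynomials in two variables\<close>

text \<open>
  A polynomial in \<open>X\<^sub>1, X\<^sub>2\<close> is a polynomial in \<open>X\<^sub>2\<close> whose coefficients are polynomials in \<open>X\<^sub>1\<close>;
  its value at \<open>(x, y)\<close> is \<open>poly (poly P [:y:]) x\<close>.
\<close>

definition V2 :: "nat \<Rightarrow> nat \<Rightarrow> rat poly poly set" where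
  "V2 k1 k2 = {P \<in> V k2. \<forall>m. coeff P m \<in> V k1}"

definition slash2 :: "nat \<Rightarrow> nat \<Rightarrow> (int^2^2) \<times> (int^2^2) \<Rightarrow> rat poly poly \<Rightarrow> rat poly poly" where
  "slash2 k1 k2 = (\<lambda>(\<gamma>1, \<gamma>2) P. slash k2 \<gamma>2 (map_poly (slash k1 \<gamma>1) P))"

definition V2_ID :: "nat \<Rightarrow> nat \<Rightarrow> rat poly poly set" where
  "V2_ID k1 k2 = {P \<in> V2 k1 k2.
     P + slash2 k1 k2 (S, S) P = 0 \<and>
     P + slash2 k1 k2 (U, U) P + slash2 k1 k2 (U ** U, U ** U) P = 0}"

definition reflect2 :: "rat poly poly \<Rightarrow> rat poly poly" where
  "reflect2 P = map_poly (\<lambda>p. pcompose p [:0, -1:]) (pcompose P [:0, -1:])"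

definition V2_sign :: "nat \<Rightarrow> nat \<Rightarrow> rat \<Rightarrow> rat poly poly set" where
  "V2_sign k1 k2 \<epsilon> = {P \<in> V2 k1 k2. reflect2 P = smult [:\<epsilon>:] P}"

lemma poly_slash2:
  fixes \<gamma>1 \<gamma>2 :: "int^2^2" and x y :: rat
  defines "n1 \<equiv> of_int (\<gamma>1$1$1) * x + of_int (\<gamma>1$1$2)"
    and "d1 \<equiv> of_int (\<gamma>1$2$1) * x + of_int (\<gamma>1$2$2)"
    and "n2 \<equiv> of_int (\<gamma>2$1$1) * y + of_int (\<gamma>2$1$2)"
    and "d2 \<equiv> of_int (\<gamma>2$2$1) * y + of_int (\<gamma>2$2$2)"
  assumes P: "P \<in> V2 k1 k2" and "d1 \<noteq> 0" "d2 \<noteq> 0"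
  shows "poly (poly (slash2 k1 k2 (\<gamma>1, \<gamma>2) P) [:y:]) x =
    d1 ^ (k1 - 2) * d2 ^ (k2 - 2) * poly (poly P [:n2 / d2:]) (n1 / d1)"
proof -
  have PV: "P \<in> V k2" and PC: "\<And>m. coeff P m \<in> V k1"
    using P by (auto simp: V2_def)
  have *: "n2 ^ i * d2 ^ (k2 - 2 - i) = d2 ^ (k2 - 2) * (n2 / d2) ^ i" if "i \<le> k2 - 2" for i
  proof -
    have "d2 ^ (k2 - 2) = d2 ^ i * d2 ^ (k2 - 2 - i)"
      by (simp only: le_add_diff_inverse[OF that] flip: power_add)
    then show ?thesis using \<open>d2 \<noteq> 0\<close> by (simp add: power_divide)
  qed
  have ev: "poly (poly P [:z:]) w = (\<Sum>i\<le>k2 - 2. poly (coeff P i) w * z ^ i)" for z w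
  proof -
    have "poly P [:z:] = (\<Sum>i\<le>k2 - 2. coeff P i * [:z:] ^ i)"
      by (rule poly_V) fact
    then show ?thesis by (simp add: poly_sum)
  qed
  have slash1: "poly (slash k1 \<gamma>1 (coeff P i)) x = d1 ^ (k1 - 2) * poly (coeff P i) (n1 / d1)" for i
    using \<open>d1 \<noteq> 0\<close> unfolding n1_def d1_def by (rule poly_slash[OF PC])
  have lin: "poly (poly [:of_int a, of_int b:] [:y:]) x = of_int b * y + of_int a" for a b :: int
    by (simp add: of_int_poly add.commute mult.commute)
  have "poly (poly (slash2 k1 k2 (\<gamma>1, \<gamma>2) P) [:y:]) x =
      (\<Sum>i\<le>k2 - 2. poly (slash k1 \<gamma>1 (coeff P i)) x * (n2 ^ i * d2 ^ (k2 - 2 - i)))"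
    unfolding slash2_def prod.case slash_def[of k2]
    by (simp add: poly_sum coeff_map_poly lin n2_def d2_def del: poly_pCons)
  also have "\<dots> = (\<Sum>i\<le>k2 - 2. d1 ^ (k1 - 2) * d2 ^ (k2 - 2) *
      (poly (coeff P i) (n1 / d1) * (n2 / d2) ^ i))"
    by (intro sum.cong refl, subst *) (simp, simp only: slash1 mult_ac)
  also have "\<dots> = d1 ^ (k1 - 2) * d2 ^ (k2 - 2) * poly (poly P [:n2 / d2:]) (n1 / d1)"
    by (simp only: ev sum_distrib_left)
  finally show ?thesis .
qed

lemma poly_reflect2:
  "poly (poly (reflect2 P) [:y:]) x = poly (poly P [:- y:]) (- x)"
proof -
  have *: "poly (poly (map_poly (\<lambda>p. pcompose p [:0, -1:]) Q) [:y:]) x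
      = poly (poly Q [:y:]) (- x)" for Q :: "rat poly poly"
    by (induction Q) (simp_all add: map_poly_pCons poly_pcompose)
  show ?thesis by (simp add: reflect2_def * poly_pcompose)
qed

section \<open>Direct sums and isomorphisms of rational vector spaces\<close>

definition direct_sum :: "nat set \<Rightarrow> (nat \<Rightarrow> rat poly set) \<Rightarrow> (nat \<Rightarrow> rat poly) set" where
  "direct_sum I A = {f. finite {i. f i \<noteq> 0} \<and> (\<forall>i\<in>I. f i \<in> A i) \<and> (\<forall>i. i \<notin> I \<longrightarrow> f i = 0)}"

text \<open>
  Isomorphism between a subspace \<open>A\<close> of the bivariate polynomials and a subspace \<open>B\<close> of the families
  of univariate polynomials (with pointwise operations).
\<close>

definition iso_rat :: "rat poly poly set \<Rightarrow> (nat \<Rightarrow> rat poly) set \<Rightarrow> bool" (infix \<open>\<cong>\<^sub>\<rat>\<close> 50) where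
  "A \<cong>\<^sub>\<rat> B \<longleftrightarrow> (\<exists>f. bij_betw f A B \<and>
     (\<forall>P\<in>A. \<forall>Q\<in>A. f (P + Q) = f P + f Q) \<and>
     (\<forall>c. \<forall>P\<in>A. f (smult [:c:] P) = (\<lambda>i. smult c (f P i))))"

text \<open>
  The summands of the decomposition come from the Clebsch--Gordan formula for
  \<open>V k1 \<otimes> V k2\<close>. With \<open>w = k - 2\<close> the degree belonging to the weight \<open>k\<close>, these are the
  spaces of degree \<open>w1 + w2 - 2 i\<close> for \<open>0 \<le> i \<le> min w1 w2\<close>, that is, of weight \<open>k1 + k2 - 2 - 2 i\<close>
  for \<open>0 \<le> i \<le> min k1 k2 - 2\<close>. Beware that weights \<open>k1 + k2 - 2 i\<close> with \<open>0 \<le> i \<le> min k1 k2\<close>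
  would only be right if \<open>k1, k2, k1 + k2 - 2 i\<close> were degrees: for \<open>k1 = k2 = 2\<close> the following two
  lemmas show that the summand \<open>W 4\<close> is then too large.
\<close>

lemma W_4_nontrivial: "[:-1, 0, 1:] \<in> W 4"
proof -
  have "[:-1, 0, 1 :: rat:] \<in> V 4"
    using le_degree[of "[:-1, 0, 1 :: rat:]"] by (force simp: V_def)
  moreover have "{..4 - 2} = {0, 1, 2 :: nat}" by auto
  ultimately show ?thesis
    by (simp add: W_def slash_def S_def U_def matrix_matrix_mult_def sum_2 vector_2
        power2_eq_square coeff_pCons)
qed

lemma V2_ID_2_2: "V2_ID 2 2 = {0}"
proof -
  have "P = 0" if "P \<in> V2_ID 2 2" for P
  proof -
    have P: "P \<in> V2 2 2" and eq: "P + slash2 2 2 (S, S) P = 0"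
      using that by (auto simp: V2_ID_def)
    have "degree P = 0"
      using V_degree_le[of P 2] P by (simp add: V2_def)
    then obtain p where p: "P = [:p:]" by (metis degree_eq_zeroE)
    have "coeff P 0 \<in> V 2" using P unfolding V2_def by blast
    then have "degree p = 0"
      using V_degree_le[of p 2] p by simp
    then obtain a where "p = [:a:]" by (metis degree_eq_zeroE)
    with eq p show "P = 0"
      by (simp add: slash2_def slash_def map_poly_pCons)
  qed
  moreover have "0 \<in> V2_ID 2 2"
    by (simp add: V2_ID_def V2_def V_def slash2_def)
  ultimately show ?thesis by blast
qed

end

theory Submission
  imports Defs
begin

text \<open>
  The isomorphism is the inverse of an explicit Clebsch--Gordan map. Polarization is a section of
  the restriction \<open>P(X\<^sub>1, X\<^sub>2) \<mapsto> P(X, X)\<close> to the diagonal, whose kernel consists of the multiples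
  of \<open>X\<^sub>2 - X\<^sub>1\<close>; hence every bivariate polynomial is uniquely a sum of terms
  \<open>(X\<^sub>2 - X\<^sub>1)\<^sup>i\<close> times the polarization of some \<open>f\<^sub>i\<close>. Polarization commutes with the slash
  action, as one sees on powers of linear forms, and so does multiplication by \<open>X\<^sub>2 - X\<^sub>1\<close> for
  matrices of determinant 1, if the weights are raised by 1. The reflection changes the sign of
  \<open>X\<^sub>2 - X\<^sub>1\<close>, which gives the sign \<open>(-1)\<^sup>i\<close>.
\<close>

section \<open>Polynomial identities from values\<close>

abbreviation ev :: "rat poly poly \<Rightarrow> rat \<Rightarrow> rat \<Rightarrow> rat" where
  "ev P x y \<equiv> poly (poly P [:y:]) x"

text \<open>The finite exceptional set \<open>A\<close> leaves room for the poles of a fractional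
  linear map. For \<open>y\<close> outside \<open>A\<close> the difference vanishes at infinitely
  many \<open>x\<close>, hence identically; so \<open>P - Q\<close>, seen over the domain of
  polynomials in X1, has infinitely many constant roots \<open>[:y:]\<close>.\<close>

lemma bivariate_eqI:
  assumes "finite A" and eq: "\<And>x y. x \<notin> A \<Longrightarrow> y \<notin> A \<Longrightarrow> ev P x y = ev Q x y"
  shows "P = Q"
proof -
  have inf: "infinite (- A)"
    using \<open>finite A\<close> by (metis finite_compl infinite_UNIV_char_0)
  have "poly (P - Q) [:y:] = 0" if "y \<notin> A" for y
  proof (rule ccontr)
    assume "poly (P - Q) [:y:] \<noteq> 0"
    moreover have "- A \<subseteq> {x. poly (poly (P - Q) [:y:]) x = 0}"
      using eq that by auto
    ultimately show False
      using inf poly_roots_finite finite_subset by blast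
  qed
  then have "(\<lambda>y. [:y:]) ` (- A) \<subseteq> {z. poly (P - Q) z = 0}" by auto
  moreover have "infinite ((\<lambda>y. [:y:]) ` (- A))"
    using inf by (subst finite_image_iff) (auto simp: inj_on_def)
  ultimately have "P - Q = 0"
    using poly_roots_finite finite_subset by blast
  then show ?thesis by simp
qed

section \<open>Spaces of bounded degree and the slash action\<close>

lemma V_add: "P \<in> V k \<Longrightarrow> Q \<in> V k \<Longrightarrow> P + Q \<in> V k"
  for P Q :: "'a::comm_monoid_add poly"
  unfolding V_def by (auto simp: coeff_add) (metis add.right_neutral)+

lemma V_smult: "P \<in> V k \<Longrightarrow> smult c P \<in> V k"
  for P :: "'a::comm_semiring_0 poly"
  unfolding V_def by (auto simp: coeff_smult) (metis mult_zero_right)+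

lemma V_0 [simp]: "0 \<in> V k"
  by (simp add: V_def)

lemma V_sum: "(\<And>i. i \<in> I \<Longrightarrow> P i \<in> V k) \<Longrightarrow> sum P I \<in> V k"
  for P :: "'b \<Rightarrow> 'a::comm_monoid_add poly"
  by (induction I rule: infinite_finite_induct) (auto intro: V_add)

lemma degree_le_imp_V: "degree P + 2 \<le> k \<Longrightarrow> P \<in> V k"
  unfolding V_def using le_degree by fastforce

text \<open>For \<open>k < 2\<close> the truncated \<open>k - 2\<close> is 0, so the slash action
  could return a nonzero constant although \<open>V k\<close> is zero.\<close>

lemma slash_in_V:
  fixes P :: "rat poly"
  assumes "k \<ge> 2"
  shows "slash k \<gamma> P \<in> V k"
  unfolding slash_def
proof (intro V_sum V_smult degree_le_imp_V)
  fix n assume "n \<in> {..k - 2}"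
  let ?p = "[:of_int (\<gamma>$1$2), of_int (\<gamma>$1$1) :: rat:]" and ?q = "[:of_int (\<gamma>$2$2), of_int (\<gamma>$2$1) :: rat:]"
  have "degree (?p ^ n * ?q ^ (k - 2 - n)) \<le> degree ?p * n + degree ?q * (k - 2 - n)"
    by (intro degree_mult_le[THEN order_trans] add_mono degree_power_le)
  also have "\<dots> \<le> 1 * n + 1 * (k - 2 - n)"
    by (intro add_mono mult_right_mono) auto
  finally show "degree (?p ^ n * ?q ^ (k - 2 - n)) + 2 \<le> k"
    using \<open>n \<in> _\<close> assms by simp
qed

lemma smult_sum_right: "smult c (sum f I) = (\<Sum>i\<in>I. smult c (f i))"
  by (induction I rule: infinite_finite_induct) (auto simp: smult_add_right)

lemma slash_add: "slash k \<gamma> (P + Q) = slash k \<gamma> P + slash k \<gamma> Q"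
  by (simp add: slash_def smult_add_left sum.distrib)

lemma slash_smult: "slash k \<gamma> (smult c P) = smult c (slash k \<gamma> P)"
  by (simp add: slash_def smult_sum_right mult_ac)

lemma V2_iff: "P \<in> V2 k1 k2 \<longleftrightarrow> (\<forall>m n. coeff (coeff P m) n \<noteq> 0 \<longrightarrow> m + 2 \<le> k2 \<and> n + 2 \<le> k1)"
proof -
  have "coeff P m \<noteq> 0 \<longleftrightarrow> (\<exists>n. coeff (coeff P m) n \<noteq> 0)" for m
    by (simp add: poly_eq_iff)
  then show ?thesis unfolding V2_def V_def by blast
qed

lemma V2_eq_0: "P \<in> V2 (Suc m1) (Suc m2) \<Longrightarrow> m1 = 0 \<or> m2 = 0 \<Longrightarrow> P = 0"
  by (intro poly_eqI) (fastforce simp: V2_iff)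

lemma V2_add: "P \<in> V2 k1 k2 \<Longrightarrow> Q \<in> V2 k1 k2 \<Longrightarrow> P + Q \<in> V2 k1 k2"
  by (simp add: V2_def V_add)

lemma V2_smult: "P \<in> V2 k1 k2 \<Longrightarrow> smult [:c:] P \<in> V2 k1 k2"
  by (simp add: V2_def V_smult)

lemma zero_in_V2 [simp]: "0 \<in> V2 k1 k2"
  by (simp add: V2_def)

lemma V2_sum: "(\<And>i. i \<in> I \<Longrightarrow> P i \<in> V2 k1 k2) \<Longrightarrow> sum P I \<in> V2 k1 k2"
  by (induction I rule: infinite_finite_induct) (auto intro: V2_add)

lemma V2_diff: "P \<in> V2 k1 k2 \<Longrightarrow> Q \<in> V2 k1 k2 \<Longrightarrow> P - Q \<in> V2 k1 k2"
proof -
  assume "P \<in> V2 k1 k2" "Q \<in> V2 k1 k2"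
  then have "P + smult [:-1:] Q \<in> V2 k1 k2" by (intro V2_add V2_smult)
  moreover have "P + smult [:-1:] Q = P - Q" by (intro poly_eqI) simp
  ultimately show ?thesis by simp
qed

lemma V2_diagonal:
  assumes "P \<in> V2 (Suc m1) (Suc m2)"
  shows "poly P [:0, 1:] \<in> V (m1 + m2)"
\<comment> \<open>With a zero-dimensional factor, the truncated \<open>Suc m1 - 2\<close> or
  \<open>Suc m2 - 2\<close> would make the degree bound too weak; there P itself is 0.\<close>
proof (cases "m1 = 0 \<or> m2 = 0")
  case True
  then have "P = 0"
    using assms by (rule V2_eq_0[rotated])
  then show ?thesis by simp
next
  case False
  have P: "P \<in> V (Suc m2)" "\<And>m. coeff P m \<in> V (Suc m1)"
    using assms by (auto simp: V2_def)
  have *: "degree (coeff P i * [:0, 1:] ^ i) + 2 \<le> m1 + m2" if "i \<le> Suc m2 - 2" for i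
  proof -
    have "degree (coeff P i * [:0, 1:] ^ i) \<le> (Suc m1 - 2) + (Suc m2 - 2)"
      using V_degree_le[OF P(2), of i] degree_power_le[of "[:0, 1 :: rat:]" i] that
      by (intro degree_mult_le[THEN order_trans] add_mono) auto
    then show ?thesis using False by linarith
  qed
  show ?thesis
    unfolding poly_V[OF P(1)] using * by (intro V_sum degree_le_imp_V) auto
qed

section \<open>Multiplication by X2 - X1\<close>

definition X2_minus_X1 :: "rat poly poly" where
  "X2_minus_X1 = [:[:0, -1:], 1:]"

lemma X2_minus_X1_simps [simp]:
  "ev X2_minus_X1 x y = y - x" "poly X2_minus_X1 [:0, 1:] = 0" "X2_minus_X1 \<noteq> 0"
  by (simp_all add: X2_minus_X1_def)

lemma coeff_X2_minus_X1_mult: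
  "coeff (coeff (X2_minus_X1 * Q) m) n =
    (if m = 0 then 0 else coeff (coeff Q (m - 1)) n) - (if n = 0 then 0 else coeff (coeff Q m) (n - 1))"
  by (cases m; cases n) (simp_all add: X2_minus_X1_def mult_pCons_left coeff_pCons)

lemma X2_minus_X1_mult_in_V2:
  assumes "Q \<in> V2 k1 k2"
  shows "X2_minus_X1 * Q \<in> V2 (Suc k1) (Suc k2)"
  unfolding V2_iff
proof (intro allI impI)
  fix m n assume "coeff (coeff (X2_minus_X1 * Q) m) n \<noteq> 0"
  then have "m \<noteq> 0 \<and> coeff (coeff Q (m - 1)) n \<noteq> 0 \<or> n \<noteq> 0 \<and> coeff (coeff Q m) (n - 1) \<noteq> 0"
    unfolding coeff_X2_minus_X1_mult by (auto split: if_splits)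
  then show "m + 2 \<le> Suc k2 \<and> n + 2 \<le> Suc k1"
    using assms unfolding V2_iff by fastforce
qed

text \<open>Outside the degree bounds the product has zero coefficients, so there the coefficients
  of \<open>Q\<close> are constant along antidiagonals. Following an antidiagonal to the edge, where
  one index would become negative, shows that they vanish.\<close>

lemma V2_quotient:
  assumes "X2_minus_X1 * Q \<in> V2 (Suc k1) (Suc k2)"
  shows "Q \<in> V2 k1 k2"
proof -
  let ?c = "\<lambda>m n. coeff (coeff Q m) n"
  have zero: "(if m = 0 then 0 else ?c (m - 1) n) = (if n = 0 then 0 else ?c m (n - 1))"
    if "k2 < m + 1 \<or> k1 < n + 1" for m n
  proof -
    have "coeff (coeff (X2_minus_X1 * Q) m) n = 0"
      using assms[unfolded V2_iff, rule_format, of m n] that by fastforce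
    then show ?thesis by (simp only: coeff_X2_minus_X1_mult eq_iff_diff_eq_0[symmetric])
  qed
  have "?c m n = 0" if "k1 < n + 2" for m n
    using that
  proof (induction m arbitrary: n)
    case 0
    then show ?case using zero[of 0 "n + 1"] by simp
  next
    case (Suc m)
    then show ?case using zero[of "Suc m" "n + 1"] by simp
  qed
  moreover have "?c m n = 0" if "k2 < m + 2" for m n
    using that
  proof (induction n arbitrary: m)
    case 0
    then show ?case using zero[of "m + 1" 0] by simp
  next
    case (Suc n)
    then show ?case using zero[of "m + 1" "Suc n"] by simp
  qed
  ultimately show ?thesis
    unfolding V2_iff by (meson not_le)
qed

section \<open>Polarization and its equivariance\<close>

text \<open>The linear map sending \<open>(p + q X)\<^bsup>u + v\<^esup>\<close> to \<open>(p + q X\<^sub>1)\<^sup>u (p + q X\<^sub>2)\<^sup>v\<close>.\<close>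

definition polarize :: "nat \<Rightarrow> nat \<Rightarrow> rat poly \<Rightarrow> rat poly poly" where
  "polarize u v F = (\<Sum>a\<le>u. \<Sum>b\<le>v. monom (monom
     (of_nat (u choose a) * of_nat (v choose b) / of_nat ((u + v) choose (a + b)) * coeff F (a + b)) a) b)"

lemma polarize_in_V2: "polarize u v F \<in> V2 (u + 2) (v + 2)"
  unfolding polarize_def by (intro V2_sum) (auto simp: V2_iff)

lemma polarize_add: "polarize u v (F + G) = polarize u v F + polarize u v G"
  by (simp add: polarize_def distrib_left sum.distrib flip: add_monom)

lemma polarize_smult: "polarize u v (smult c F) = smult [:c:] (polarize u v F)"
  by (simp add: polarize_def smult_sum_right smult_monom mult_ac)

lemma ev_polarize: "ev (polarize u v F) x y = (\<Sum>a\<le>u. \<Sum>b\<le>v.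
    of_nat (u choose a) * of_nat (v choose b) / of_nat ((u + v) choose (a + b)) * coeff F (a + b) * x ^ a * y ^ b)"
  by (simp add: polarize_def poly_sum poly_monom)

text \<open>The denominator in \<open>polarize\<close> cancels the binomial coefficient that occurs
  in the power of the linear form. What remains is the product of two binomial expansions.\<close>

lemma ev_polarize_power: "ev (polarize u v ([:p, q:] ^ (u + v))) x y = (p + q * x) ^ u * (p + q * y) ^ v"
proof -
  have "ev (polarize u v ([:p, q:] ^ (u + v))) x y =
    (\<Sum>a\<le>u. \<Sum>b\<le>v. (of_nat (u choose a) * (q * x) ^ a * p ^ (u - a)) * (of_nat (v choose b) * (q * y) ^ b * p ^ (v - b)))"
    unfolding ev_polarize
  proof (intro sum.cong refl)
    fix a b assume "a \<in> {..u}" "b \<in> {..v}"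
    then have le: "a + b \<le> u + v" and diff: "u + v - (a + b) = (u - a) + (v - b)"
      by auto
    have coeff: "coeff ([:p, q:] ^ (u + v)) (a + b) =
        of_nat ((u + v) choose (a + b)) * (q ^ a * q ^ b * (p ^ (u - a) * p ^ (v - b)))"
      unfolding coeff_linear_poly_power[OF le] diff by (simp only: power_add mult.assoc)
    have "of_nat ((u + v) choose (a + b)) \<noteq> (0 :: rat)"
      using le by simp
    then have cancel: "c / of_nat ((u + v) choose (a + b)) * (of_nat ((u + v) choose (a + b)) * r) = c * r"
      for c r :: rat by simp
    show "of_nat (u choose a) * of_nat (v choose b) / of_nat ((u + v) choose (a + b)) *
        coeff ([:p, q:] ^ (u + v)) (a + b) * x ^ a * y ^ b =
      (of_nat (u choose a) * (q * x) ^ a * p ^ (u - a)) * (of_nat (v choose b) * (q * y) ^ b * p ^ (v - b))"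
      unfolding coeff cancel by (simp only: power_mult_distrib mult_ac)
  qed
  also have "\<dots> = (q * x + p) ^ u * (q * y + p) ^ v"
    by (simp add: binomial_ring sum_product)
  finally show ?thesis by (simp add: add.commute)
qed

text \<open>\<open>L ((1 + t X)\<^sup>w)\<close> is a polynomial in \<open>t\<close> with coefficients \<open>(w choose n) * L (X\<^sup>n)\<close>.\<close>

lemma functional_eq_0I:
  fixes L :: "rat poly \<Rightarrow> rat"
  assumes add: "\<And>F G. L (F + G) = L F + L G" and smult: "\<And>c F. L (smult c F) = c * L F"
    and pow: "\<And>t. L ([:1, t:] ^ w) = 0" and F: "degree F \<le> w"
  shows "L F = 0"
proof -
  have sum: "L (sum g I) = (\<Sum>i\<in>I. L (g i))" if "finite I" for g and I :: "nat set"
    using that smult[of 0 0] by induction (auto simp: add)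
  have expand: "L G = (\<Sum>n\<le>w. coeff G n * L (monom 1 n))" if "degree G \<le> w" for G
  proof -
    have "G = (\<Sum>n\<le>w. smult (coeff G n) (monom 1 n))"
      using poly_as_sum_of_monoms'[OF that] by (simp add: smult_monom)
    then have "L G = L (\<Sum>n\<le>w. smult (coeff G n) (monom 1 n))"
      by (rule arg_cong)
    also have "\<dots> = (\<Sum>n\<le>w. coeff G n * L (monom 1 n))"
      by (simp only: sum smult finite_atMost)
    finally show ?thesis .
  qed
  define p where "p = (\<Sum>n\<le>w. monom (of_nat (w choose n) * L (monom 1 n)) n)"
  have "poly p t = 0" for t
  proof -
    have "degree ([:1, t:] ^ w) \<le> w"
      using degree_power_le[of "[:1, t:]" w] by (cases "t = 0") auto
    from expand[OF this] show ?thesis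
      by (simp add: pow p_def poly_sum poly_monom coeff_linear_poly_power mult_ac)
  qed
  then have "p = 0" using poly_all_0_iff_0 by blast
  have "L (monom 1 n) = 0" if "n \<le> w" for n
  proof -
    have "coeff p n = of_nat (w choose n) * L (monom 1 n)"
      using that by (simp add: p_def coeff_sum)
    then show ?thesis using \<open>p = 0\<close> that by simp
  qed
  then show ?thesis using expand[OF F] by simp
qed

text \<open>By \<open>functional_eq_0I\<close> it suffices to treat powers of
  \<open>1 + t X\<close>, for which setting both variables to \<open>x\<close> merges the two
  factors into one power.\<close>

lemma polarize_diagonal:
  assumes "F \<in> V (u + v + 2)"
  shows "poly (polarize u v F) [:0, 1:] = F"
proof -
  have ev_diag: "poly (poly P [:0, 1:]) x = ev P x x" for P :: "rat poly poly" and x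
    by (induction P) auto
  have "ev (polarize u v F) x x - poly F x = 0" for x
  proof (rule functional_eq_0I[where w = "u + v" and F = F])
    show "degree F \<le> u + v" using V_degree_le[OF assms] by simp
    fix t show "ev (polarize u v ([:1, t:] ^ (u + v))) x x - poly ([:1, t:] ^ (u + v)) x = 0"
      by (simp only: ev_polarize_power poly_power) (simp add: power_add mult.commute)
  qed (simp_all add: polarize_add polarize_smult algebra_simps)
  then show ?thesis
    by (intro iffD1[OF poly_eq_poly_eq_iff]) (simp add: fun_eq_iff ev_diag)
qed

text \<open>The sum defining \<open>slash\<close> becomes the binomial expansion of
  \<open>(t (a X + b) + (c X + d)) ^ w\<close>. So powers of linear forms go to powers of linear
  forms, on which polarization is explicit.\<close>

lemma slash_power: "slash (w + 2) \<gamma> ([:1, t:] ^ w) =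
    ([:of_int (\<gamma>$2$2) + t * of_int (\<gamma>$1$2), of_int (\<gamma>$2$1) + t * of_int (\<gamma>$1$1):] ^ w :: rat poly)"
proof -
  let ?p = "[:of_int (\<gamma>$1$2), of_int (\<gamma>$1$1) :: rat:]" and ?q = "[:of_int (\<gamma>$2$2), of_int (\<gamma>$2$1) :: rat:]"
  have "slash (w + 2) \<gamma> ([:1, t:] ^ w) = (smult t ?p + ?q) ^ w"
    unfolding slash_def binomial_ring
    by (intro sum.cong)
      (simp_all add: coeff_linear_poly_power smult_power of_nat_poly mult_ac del: smult_pCons)
  then show ?thesis by (simp add: add.commute)
qed

text \<open>Both sides are linear in \<open>F\<close>, which reduces the claim to powers of
  \<open>1 + t X\<close>. There it amounts to the identity \<open>*\<close>, used once for each
  variable: the transformed linear form at \<open>z\<close> is \<open>d z\<close> times the original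
  one at \<open>g z\<close>.\<close>

lemma ev_polarize_slash:
  fixes \<gamma> :: "int^2^2" and x y :: rat
  defines "d \<equiv> \<lambda>z. of_int (\<gamma>$2$1) * z + of_int (\<gamma>$2$2)"
    and "g \<equiv> \<lambda>z. (of_int (\<gamma>$1$1) * z + of_int (\<gamma>$1$2)) / (of_int (\<gamma>$2$1) * z + of_int (\<gamma>$2$2))"
  assumes F: "F \<in> V (u + v + 2)" and "d x \<noteq> 0" "d y \<noteq> 0"
  shows "ev (polarize u v (slash (u + v + 2) \<gamma> F)) x y = d x ^ u * d y ^ v * ev (polarize u v F) (g x) (g y)"
proof -
  have *: "of_int (\<gamma>$2$2) + t * of_int (\<gamma>$1$2) + (of_int (\<gamma>$2$1) + t * of_int (\<gamma>$1$1)) * z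
      = d z * (1 + t * g z)" if "d z \<noteq> 0" for t z
    using that by (simp add: d_def g_def field_simps)
  have "ev (polarize u v (slash (u + v + 2) \<gamma> F)) x y - d x ^ u * d y ^ v * ev (polarize u v F) (g x) (g y) = 0"
  proof (rule functional_eq_0I[where w = "u + v" and F = F])
    show "degree F \<le> u + v" using V_degree_le[OF F] by simp
    fix t
    show "ev (polarize u v (slash (u + v + 2) \<gamma> ([:1, t:] ^ (u + v)))) x y -
        d x ^ u * d y ^ v * ev (polarize u v ([:1, t:] ^ (u + v))) (g x) (g y) = 0"
      unfolding slash_power ev_polarize_power *[OF \<open>d x \<noteq> 0\<close>] *[OF \<open>d y \<noteq> 0\<close>]
      by (simp add: power_mult_distrib)
  qed (simp_all add: slash_add slash_smult polarize_add polarize_smult algebra_simps)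
  then show ?thesis by simp
qed

lemma ev_polarize_reflect:
  "ev (polarize u v (pcompose F [:0, -1:])) x y = ev (polarize u v F) (- x) (- y)"
  unfolding ev_polarize
  by (intro sum.cong refl) (simp add: coeff_pcompose_linear power_add power_minus[of x] power_minus[of y])

section \<open>The Clebsch-Gordan map and its bijectivity\<close>

text \<open>The parameters \<open>m1\<close>, \<open>m2\<close> are the dimensions \<open>k1 - 1\<close>, \<open>k2 - 1\<close> of the two factors, so that the
  recursion ends at zero-dimensional spaces.\<close>

fun clebsch_gordan :: "nat \<Rightarrow> nat \<Rightarrow> (nat \<Rightarrow> rat poly) \<Rightarrow> rat poly poly" where
  "clebsch_gordan (Suc m1) (Suc m2) f =
     polarize m1 m2 (f 0) + X2_minus_X1 * clebsch_gordan m1 m2 (\<lambda>i. f (Suc i))"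
| "clebsch_gordan 0 m2 f = 0"
| "clebsch_gordan m1 0 f = 0"


lemma clebsch_gordan_0_right [simp]: "clebsch_gordan m1 0 f = 0"
  by (cases m1) auto

lemma clebsch_gordan_in_V2: "clebsch_gordan m1 m2 f \<in> V2 (Suc m1) (Suc m2)"
proof (induction m1 m2 f rule: clebsch_gordan.induct)
  case (1 m1 m2 f)
  then show ?case
    using polarize_in_V2[of m1 m2 "f 0"] by (auto intro!: V2_add X2_minus_X1_mult_in_V2)
qed auto

lemma clebsch_gordan_add:
  "clebsch_gordan m1 m2 (\<lambda>i. f i + g i) = clebsch_gordan m1 m2 f + clebsch_gordan m1 m2 g"
  by (induction m1 m2 f arbitrary: g rule: clebsch_gordan.induct) (simp_all add: polarize_add distrib_left)

lemma clebsch_gordan_smult: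
  "clebsch_gordan m1 m2 (\<lambda>i. smult c (f i)) = smult [:c:] (clebsch_gordan m1 m2 f)"
  by (induction m1 m2 f rule: clebsch_gordan.induct)
    (simp_all only: clebsch_gordan.simps polarize_smult smult_add_right mult_smult_right smult_0_right)

lemma direct_sum_iff:
  assumes "finite I"
  shows "f \<in> direct_sum I A \<longleftrightarrow> (\<forall>i\<in>I. f i \<in> A i) \<and> (\<forall>i. i \<notin> I \<longrightarrow> f i = 0)"
proof -
  have "finite {i. f i \<noteq> 0}" if "\<forall>i. i \<notin> I \<longrightarrow> f i = 0"
    using that assms by (auto intro: finite_subset[of _ I])
  then show ?thesis unfolding direct_sum_def by blast
qed

text \<open>In the range \<open>i < min m1 m2\<close> the subtraction does not truncate and every
  weight is at least 2, as \<open>slash_in_V\<close> requires.\<close>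

definition V_family :: "nat \<Rightarrow> nat \<Rightarrow> (nat \<Rightarrow> rat poly) set" where
  "V_family m1 m2 = direct_sum {..<min m1 m2} (\<lambda>i. V (m1 + m2 - 2 * i))"

lemma V_family_iff: "f \<in> V_family m1 m2 \<longleftrightarrow>
    (\<forall>i<min m1 m2. f i \<in> V (m1 + m2 - 2 * i)) \<and> (\<forall>i\<ge>min m1 m2. f i = 0)"
  unfolding V_family_def direct_sum_iff[OF finite_lessThan] by (simp only: lessThan_iff not_less Ball_def)

text \<open>Lowering both dimensions by 1 compensates the index shift in the weight, which matches
  the recursion of \<open>clebsch_gordan\<close>.\<close>

lemma V_family_Suc: "f \<in> V_family (Suc m1) (Suc m2) \<longleftrightarrow>
    f 0 \<in> V (m1 + m2 + 2) \<and> (\<lambda>i. f (Suc i)) \<in> V_family m1 m2"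
proof -
  have "(\<forall>i\<ge>Suc n. f i = 0) \<longleftrightarrow> (\<forall>i\<ge>n. f (Suc i) = 0)" for n
    by (metis Suc_le_D Suc_le_mono)
  then show ?thesis
    unfolding V_family_iff min_Suc_Suc All_less_Suc2 by simp
qed

lemma V_family_add: "f \<in> V_family m1 m2 \<Longrightarrow> g \<in> V_family m1 m2 \<Longrightarrow> (\<lambda>i. f i + g i) \<in> V_family m1 m2"
  by (simp add: V_family_iff V_add)

lemma V_family_smult: "f \<in> V_family m1 m2 \<Longrightarrow> (\<lambda>i. smult (c i) (f i)) \<in> V_family m1 m2"
  by (simp add: V_family_iff V_smult)

lemma V_family_slash:
  "f \<in> V_family m1 m2 \<Longrightarrow> (\<lambda>i. slash (m1 + m2 - 2 * i) \<gamma> (f i)) \<in> V_family m1 m2"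
  by (auto simp: V_family_iff intro!: slash_in_V)

lemma V_reflect: "F \<in> V k \<Longrightarrow> pcompose F [:0, -1:] \<in> V k" for F :: "rat poly"
  by (simp add: V_def coeff_pcompose_linear)

lemma V_family_reflect:
  "f \<in> V_family m1 m2 \<Longrightarrow> (\<lambda>i. pcompose (f i) [:0, -1:]) \<in> V_family m1 m2"
  by (simp add: V_family_iff V_reflect)

lemma clebsch_gordan_diagonal:
  assumes "f 0 \<in> V (m1 + m2 + 2)"
  shows "poly (clebsch_gordan (Suc m1) (Suc m2) f) [:0, 1:] = f 0"
  using polarize_diagonal[OF assms] by simp

text \<open>This is injectivity: restriction to the diagonal kills every term except
  \<open>f 0\<close>, and once \<open>f 0 = 0\<close> the factor X2 - X1 can be cancelled and the
  induction continues.\<close>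

lemma clebsch_gordan_eq_0D:
  "f \<in> V_family m1 m2 \<Longrightarrow> clebsch_gordan m1 m2 f = 0 \<Longrightarrow> f i = 0"
proof (induction m1 m2 f arbitrary: i rule: clebsch_gordan.induct)
  case (1 m1 m2 f)
  have f: "f 0 \<in> V (m1 + m2 + 2)" "(\<lambda>i. f (Suc i)) \<in> V_family m1 m2"
    using "1.prems"(1) unfolding V_family_Suc by blast+
  have f0: "f 0 = 0"
    using clebsch_gordan_diagonal[of f m1 m2] f(1) unfolding "1.prems"(2) by simp
  have "polarize m1 m2 0 = 0" by (simp add: polarize_def)
  then have "X2_minus_X1 * clebsch_gordan m1 m2 (\<lambda>i. f (Suc i)) = 0"
    using "1.prems"(2) f0 by (simp)
  then have "clebsch_gordan m1 m2 (\<lambda>i. f (Suc i)) = 0"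
    by (simp)
  from "1.IH"[OF f(2) this] f0 show ?case by (cases i) auto
qed (simp_all add: V_family_iff)

text \<open>This is surjectivity: the restriction to the diagonal supplies the component of index 0.
  Subtracting its polarization leaves a multiple of X2 - X1, whose quotient lies in a smaller
  space.\<close>

lemma V2_clebsch_gordan:
  "P \<in> V2 (Suc m1) (Suc m2) \<Longrightarrow> \<exists>f\<in>V_family m1 m2. P = clebsch_gordan m1 m2 f"
proof (induction m1 arbitrary: m2 P)
  case 0
  then have "P = 0" using V2_eq_0 by blast
  then show ?case by (intro bexI[of _ "\<lambda>_. 0"]) (auto simp: V_family_iff)
next
  case (Suc m1)
  show ?case
  proof (cases m2)
    case 0
    then have "P = 0" using Suc.prems V2_eq_0 by blast
    then show ?thesis using 0 by (intro bexI[of _ "\<lambda>_. 0"]) (auto simp: V_family_iff)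
  next
    case m2: (Suc m)
    define F where "F = poly P [:0, 1:]"
    have F: "F \<in> V (m1 + m + 2)"
      using V2_diagonal[of P "Suc m1" "Suc m"] Suc.prems m2 by (simp add: F_def)
    have "poly (P - polarize m1 m F) [:0, 1:] = 0"
      using polarize_diagonal[OF F] by (simp add: F_def)
    \<comment> \<open>Over the coefficient ring of polynomials in X1 this is a monic linear factor
      with root X1, so vanishing on the diagonal means divisibility.\<close>
    moreover have "X2_minus_X1 = [:- [:0, 1:], 1:]"
      by (simp add: X2_minus_X1_def)
    ultimately have "X2_minus_X1 dvd P - polarize m1 m F"
      by (simp only: poly_eq_0_iff_dvd)
    then obtain Q where Q: "P - polarize m1 m F = X2_minus_X1 * Q"
      by (elim dvdE)
    have "P - polarize m1 m F \<in> V2 (Suc (Suc m1)) (Suc (Suc m))"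
      using polarize_in_V2[of m1 m F] Suc.prems m2 by (auto intro: V2_diff)
    then have "Q \<in> V2 (Suc m1) (Suc m)"
      unfolding Q by (rule V2_quotient)
    then obtain f where f: "f \<in> V_family m1 m" "Q = clebsch_gordan m1 m f"
      using Suc.IH by blast
    have "case_nat F f \<in> V_family (Suc m1) (Suc m)"
      using F f(1) by (simp add: V_family_Suc)
    moreover have "P = clebsch_gordan (Suc m1) (Suc m) (case_nat F f)"
      using Q f(2) by (simp add: diff_eq_eq add.commute)
    ultimately show ?thesis using m2 by blast
  qed
qed

lemma clebsch_gordan_eq_iff:
  assumes "f \<in> V_family m1 m2" "g \<in> V_family m1 m2"
  shows "clebsch_gordan m1 m2 f = clebsch_gordan m1 m2 g \<longleftrightarrow> f = g"
proof
  assume eq: "clebsch_gordan m1 m2 f = clebsch_gordan m1 m2 g"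
  have "(\<lambda>i. f i + smult (-1) (g i)) \<in> V_family m1 m2"
    by (intro V_family_add V_family_smult assms)
  moreover have "clebsch_gordan m1 m2 (\<lambda>i. f i + smult (-1) (g i)) = 0"
    by (simp only: clebsch_gordan_add clebsch_gordan_smult eq) (simp add: poly_eq_iff)
  ultimately have "f i + smult (-1) (g i) = 0" for i
    by (rule clebsch_gordan_eq_0D)
  then show "f = g" by (simp add: fun_eq_iff)
qed simp

lemma bij_betw_clebsch_gordan:
  "bij_betw (clebsch_gordan m1 m2) (V_family m1 m2) (V2 (Suc m1) (Suc m2))"
  unfolding bij_betw_def inj_on_def
  using clebsch_gordan_eq_iff clebsch_gordan_in_V2 V2_clebsch_gordan by blast

section \<open>Equivariance of the Clebsch-Gordan map\<close>

text \<open>The factor \<open>d x * d y\<close> on the left raises the natural exponents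
  \<open>m1 - 1\<close> and \<open>m2 - 1\<close> to \<open>m1\<close> and \<open>m2\<close>, so the
  induction meets no truncated subtraction.\<close>

lemma ev_clebsch_gordan_slash:
  fixes \<gamma> :: "int^2^2" and x y :: rat
  defines "d \<equiv> \<lambda>z. of_int (\<gamma>$2$1) * z + of_int (\<gamma>$2$2)"
    and "g \<equiv> \<lambda>z. (of_int (\<gamma>$1$1) * z + of_int (\<gamma>$1$2)) / (of_int (\<gamma>$2$1) * z + of_int (\<gamma>$2$2))"
  assumes det: "\<gamma>$1$1 * \<gamma>$2$2 - \<gamma>$1$2 * \<gamma>$2$1 = 1" and nz: "d x \<noteq> 0" "d y \<noteq> 0"
  shows "f \<in> V_family m1 m2 \<Longrightarrow>
    d x * d y * ev (clebsch_gordan m1 m2 (\<lambda>i. slash (m1 + m2 - 2 * i) \<gamma> (f i))) x y =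
    d x ^ m1 * d y ^ m2 * ev (clebsch_gordan m1 m2 f) (g x) (g y)"
proof (induction m1 m2 f rule: clebsch_gordan.induct)
  case (1 m1 m2 f)
  have f: "f 0 \<in> V (m1 + m2 + 2)" "(\<lambda>i. f (Suc i)) \<in> V_family m1 m2"
    using "1.prems" unfolding V_family_Suc by blast+
  \<comment> \<open>Determinant 1 enters here: it makes X2 - X1 invariant up to the factor
    \<open>d x * d y\<close>, which accounts for the shift of both weights by 1.\<close>
  have "rat_of_int (\<gamma>$1$1 * \<gamma>$2$2 - \<gamma>$1$2 * \<gamma>$2$1) = 1"
    by (simp only: det of_int_1)
  then have det': "(of_int (\<gamma>$1$1) * y + of_int (\<gamma>$1$2)) * d x - (of_int (\<gamma>$1$1) * x + of_int (\<gamma>$1$2)) * d y = y - x"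
    unfolding d_def of_int_diff of_int_mult by algebra
  have gd: "d z * g z = of_int (\<gamma>$1$1) * z + of_int (\<gamma>$1$2)" if "d z \<noteq> 0" for z
    using that by (simp add: d_def g_def)
  have "d x * d y * (g y - g x) = d x * (d y * g y) - d y * (d x * g x)"
    by (simp add: algebra_simps)
  also have "\<dots> = y - x"
    using det' by (simp add: gd nz mult.commute)
  finally have gdiff: "d x * d y * (g y - g x) = y - x" .
  let ?h = "\<lambda>i. slash (m1 + m2 - 2 * i) \<gamma> (f (Suc i))"
  have "d x * d y * ev (clebsch_gordan (Suc m1) (Suc m2) (\<lambda>i. slash (Suc m1 + Suc m2 - 2 * i) \<gamma> (f i))) x y
      = d x * d y * ev (polarize m1 m2 (slash (m1 + m2 + 2) \<gamma> (f 0))) x y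
        + (y - x) * (d x * d y * ev (clebsch_gordan m1 m2 ?h) x y)"
    by (simp add: algebra_simps)
  also have "\<dots> = d x * d y * (d x ^ m1 * d y ^ m2 * ev (polarize m1 m2 (f 0)) (g x) (g y))
      + d x * d y * (g y - g x) * (d x ^ m1 * d y ^ m2 * ev (clebsch_gordan m1 m2 (\<lambda>i. f (Suc i))) (g x) (g y))"
    unfolding gdiff "1.IH"[OF f(2)]
    using ev_polarize_slash[OF f(1), of \<gamma> x y] nz by (simp add: d_def g_def)
  also have "\<dots> = d x ^ Suc m1 * d y ^ Suc m2 * ev (clebsch_gordan (Suc m1) (Suc m2) f) (g x) (g y)"
    by (simp add: algebra_simps)
  finally show ?case .
qed auto

lemma slash2_clebsch_gordan:
  assumes det: "\<gamma>$1$1 * \<gamma>$2$2 - \<gamma>$1$2 * \<gamma>$2$1 = 1" and f: "f \<in> V_family m1 m2"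
  shows "slash2 (Suc m1) (Suc m2) (\<gamma>, \<gamma>) (clebsch_gordan m1 m2 f) =
    clebsch_gordan m1 m2 (\<lambda>i. slash (m1 + m2 - 2 * i) \<gamma> (f i))"
\<comment> \<open>If a dimension is 0, the exponent \<open>m1 - 1\<close> or \<open>m2 - 1\<close>
  would truncate, but then the map itself is zero.\<close>
proof (cases "m1 = 0 \<or> m2 = 0")
  case True
  then have "clebsch_gordan m1 m2 h = 0" for h by auto
  then show ?thesis by (simp add: slash2_def)
next
  case False
  let ?d = "\<lambda>z. of_int (\<gamma>$2$1) * z + of_int (\<gamma>$2$2) :: rat"
  have m: "?d z ^ m1 = ?d z * ?d z ^ (m1 - 1)" "?d z ^ m2 = ?d z * ?d z ^ (m2 - 1)" for z
    using False by (simp_all flip: power_Suc)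
  show ?thesis
  proof (rule bivariate_eqI)
    \<comment> \<open>A zero bottom row would make the determinant 0, so the denominator has only
      finitely many zeros.\<close>
    have "[:of_int (\<gamma>$2$2), of_int (\<gamma>$2$1) :: rat:] \<noteq> 0" using det by auto
    then have "finite {z. poly [:of_int (\<gamma>$2$2), of_int (\<gamma>$2$1) :: rat:] z = 0}"
      by (rule poly_roots_finite)
    then show "finite {z. ?d z = 0}" by (simp add: add.commute mult.commute)
  next
    fix x y assume nz: "x \<notin> {z. ?d z = 0}" "y \<notin> {z. ?d z = 0}"
    let ?g = "\<lambda>z. (of_int (\<gamma>$1$1) * z + of_int (\<gamma>$1$2)) / ?d z"
    have "ev (slash2 (Suc m1) (Suc m2) (\<gamma>, \<gamma>) (clebsch_gordan m1 m2 f)) x y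
        = ?d x ^ (m1 - 1) * ?d y ^ (m2 - 1) * ev (clebsch_gordan m1 m2 f) (?g x) (?g y)"
      using poly_slash2[OF clebsch_gordan_in_V2] nz by simp
    moreover have "?d x * ?d y * ev (clebsch_gordan m1 m2 (\<lambda>i. slash (m1 + m2 - 2 * i) \<gamma> (f i))) x y
        = ?d x * ?d y * (?d x ^ (m1 - 1) * ?d y ^ (m2 - 1) * ev (clebsch_gordan m1 m2 f) (?g x) (?g y))"
      using ev_clebsch_gordan_slash[OF det _ _ f, of x y] nz unfolding m by (simp only: mult_ac mem_Collect_eq not_False_eq_True)
    ultimately show "ev (slash2 (Suc m1) (Suc m2) (\<gamma>, \<gamma>) (clebsch_gordan m1 m2 f)) x y =
        ev (clebsch_gordan m1 m2 (\<lambda>i. slash (m1 + m2 - 2 * i) \<gamma> (f i))) x y"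
      using nz by simp
  qed
qed

lemma ev_clebsch_gordan_reflect:
  "ev (clebsch_gordan m1 m2 (\<lambda>i. smult ((-1) ^ i) (pcompose (f i) [:0, -1:]))) x y =
    ev (clebsch_gordan m1 m2 f) (- x) (- y)"
proof (induction m1 m2 f rule: clebsch_gordan.induct)
  case (1 m1 m2 f)
  \<comment> \<open>The index shift costs one sign, which turns \<open>y - x\<close> into the value
    of X2 - X1 at the reflected point.\<close>
  have "clebsch_gordan m1 m2 (\<lambda>i. smult ((-1) ^ Suc i) (pcompose (f (Suc i)) [:0, -1:])) =
      smult [:-1:] (clebsch_gordan m1 m2 (\<lambda>i. smult ((-1) ^ i) (pcompose (f (Suc i)) [:0, -1:])))"
    by (simp flip: clebsch_gordan_smult)
  then show ?case
    using "1.IH" by (simp add: ev_polarize_reflect del: power_Suc) (simp add: algebra_simps)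
qed auto

lemma reflect2_clebsch_gordan:
  "reflect2 (clebsch_gordan m1 m2 f) =
    clebsch_gordan m1 m2 (\<lambda>i. smult ((-1) ^ i) (pcompose (f i) [:0, -1:]))"
  by (rule bivariate_eqI[of "{}"]) (simp_all only: poly_reflect2 ev_clebsch_gordan_reflect finite.emptyI)

section \<open>Transfer of the period relations and parity\<close>

text \<open>Equivariance writes each relation for the image as the image of a family of relations.
  Injectivity then separates it into its components.\<close>

lemma clebsch_gordan_in_V2_ID_iff:
  assumes f: "f \<in> V_family m1 m2"
  shows "clebsch_gordan m1 m2 f \<in> V2_ID (Suc m1) (Suc m2) \<longleftrightarrow>
    f \<in> direct_sum {..<min m1 m2} (\<lambda>i. W (m1 + m2 - 2 * i))"
proof -
  let ?sl = "\<lambda>\<gamma> i. slash (m1 + m2 - 2 * i) \<gamma> (f i)"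
  let ?CG = "clebsch_gordan m1 m2"
  have eq0: "?CG h = 0 \<longleftrightarrow> (\<forall>i. h i = 0)" if "h \<in> V_family m1 m2" for h
    using clebsch_gordan_eq_iff[OF that, of "\<lambda>_. 0"] clebsch_gordan_smult[of m1 m2 0 "\<lambda>_. 0"]
    by (auto simp: V_family_iff fun_eq_iff)
  have sl: "slash2 (Suc m1) (Suc m2) (\<gamma>, \<gamma>) (?CG f) = ?CG (?sl \<gamma>)" if "\<gamma> \<in> {S, U, U ** U}" for \<gamma>
    using that f by (intro slash2_clebsch_gordan) (auto simp: S_def U_def matrix_matrix_mult_def sum_2 vector_2)
  have "?CG f \<in> V2_ID (Suc m1) (Suc m2) \<longleftrightarrow>
      ?CG (\<lambda>i. f i + ?sl S i) = 0 \<and> ?CG (\<lambda>i. f i + ?sl U i + ?sl (U ** U) i) = 0"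
    by (simp add: V2_ID_def clebsch_gordan_in_V2 sl clebsch_gordan_add)
  also have "\<dots> \<longleftrightarrow> (\<forall>i. f i + ?sl S i = 0) \<and> (\<forall>i. f i + ?sl U i + ?sl (U ** U) i = 0)"
    using f by (intro arg_cong2[of _ _ _ _ "(\<and>)"] eq0 V_family_add V_family_slash)
  also have "\<dots> \<longleftrightarrow> (\<forall>i<min m1 m2. f i + ?sl S i = 0 \<and> f i + ?sl U i + ?sl (U ** U) i = 0)"
  proof -
    \<comment> \<open>Beyond the index range the components vanish, so the relations there hold
      trivially.\<close>
    have "f i = 0" if "\<not> i < min m1 m2" for i
      using f that unfolding V_family_iff not_less by blast
    then have "f i + ?sl S i = 0 \<and> f i + ?sl U i + ?sl (U ** U) i = 0" if "\<not> i < min m1 m2" for i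
      using that by (simp only: slash_0 add_0_right simp_thms)
    then show ?thesis by blast
  qed
  also have "\<dots> \<longleftrightarrow> f \<in> direct_sum {..<min m1 m2} (\<lambda>i. W (m1 + m2 - 2 * i))"
    using f unfolding direct_sum_iff[OF finite_lessThan] V_family_iff W_def
    by (simp only: lessThan_iff not_less Ball_def mem_Collect_eq) blast
  finally show ?thesis .
qed

lemma clebsch_gordan_in_V2_sign_iff:
  assumes f: "f \<in> V_family m1 m2"
  shows "clebsch_gordan m1 m2 f \<in> V2_sign (Suc m1) (Suc m2) \<epsilon> \<longleftrightarrow>
    (\<forall>i. pcompose (f i) [:0, -1:] = smult ((-1) ^ i * \<epsilon>) (f i))"
proof -
  have "clebsch_gordan m1 m2 f \<in> V2_sign (Suc m1) (Suc m2) \<epsilon> \<longleftrightarrow>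
      clebsch_gordan m1 m2 (\<lambda>i. smult ((-1) ^ i) (pcompose (f i) [:0, -1:])) =
      clebsch_gordan m1 m2 (\<lambda>i. smult \<epsilon> (f i))"
    by (simp only: V2_sign_def clebsch_gordan_in_V2 reflect2_clebsch_gordan clebsch_gordan_smult
        mem_Collect_eq simp_thms)
  also have "\<dots> \<longleftrightarrow> (\<forall>i. smult ((-1) ^ i) (pcompose (f i) [:0, -1:]) = smult \<epsilon> (f i))"
    using f by (subst clebsch_gordan_eq_iff) (auto intro: V_family_smult V_family_reflect simp: fun_eq_iff)
  also have "\<dots> \<longleftrightarrow> (\<forall>i. pcompose (f i) [:0, -1:] = smult ((-1) ^ i * \<epsilon>) (f i))"
  proof (intro all_cong1)
    fix i
    \<comment> \<open>The sign is its own inverse, so it may change sides.\<close>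
    have "smult ((-1) ^ i) p = q \<longleftrightarrow> p = smult ((-1) ^ i) q" for p q :: "rat poly"
      by (cases "even i") auto
    then show "smult ((-1) ^ i) (pcompose (f i) [:0, -1:]) = smult \<epsilon> (f i) \<longleftrightarrow>
        pcompose (f i) [:0, -1:] = smult ((-1) ^ i * \<epsilon>) (f i)"
      by simp
  qed
  finally show ?thesis .
qed

text \<open>\<open>iso_rat\<close> asks for a map out of the bivariate polynomials, so the witness
  is the inverse of \<open>clebsch_gordan\<close>. One criterion serves the full space and its
  parity parts.\<close>

lemma iso_ratI:
  assumes A: "A \<subseteq> V2 (Suc m1) (Suc m2)" and B: "B \<subseteq> V_family m1 m2"
    and AB: "\<And>f. f \<in> V_family m1 m2 \<Longrightarrow> clebsch_gordan m1 m2 f \<in> A \<longleftrightarrow> f \<in> B"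
  shows "A \<cong>\<^sub>\<rat> B"
proof -
  let ?CG = "clebsch_gordan m1 m2" and ?D = "V_family m1 m2"
  let ?h = "inv_into ?D ?CG"
  have h: "?h P \<in> ?D" "?CG (?h P) = P" if "P \<in> V2 (Suc m1) (Suc m2)" for P
  proof -
    have "P \<in> ?CG ` ?D"
      using bij_betw_clebsch_gordan[of m1 m2] that by (simp add: bij_betw_def)
    then show "?h P \<in> ?D" "?CG (?h P) = P" by (rule inv_into_into, rule f_inv_into_f)
  qed
  \<comment> \<open>This reduces linearity of the inverse to linearity of
    \<open>clebsch_gordan\<close>.\<close>
  have hI: "?h P = f" if "f \<in> ?D" "?CG f = P" for P f
    using bij_betw_clebsch_gordan[of m1 m2] that by (auto simp: bij_betw_def)
  have "bij_betw ?h A B"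
  proof (rule bij_betw_byWitness[where f' = ?CG])
    show "?h ` A \<subseteq> B"
    proof (intro image_subsetI)
      fix P assume "P \<in> A"
      with A h[of P] AB[of "?h P"] show "?h P \<in> B" by auto
    qed
    show "?CG ` B \<subseteq> A" using AB B by blast
    show "\<forall>P\<in>A. ?CG (?h P) = P" using A h(2) by blast
    show "\<forall>f\<in>B. ?h (?CG f) = f" using B hI by blast
  qed
  moreover have "?h (P + Q) = ?h P + ?h Q" if "P \<in> A" "Q \<in> A" for P Q
  proof (rule hI)
    have "P \<in> V2 (Suc m1) (Suc m2)" "Q \<in> V2 (Suc m1) (Suc m2)" using that A by auto
    then show "?h P + ?h Q \<in> ?D" "?CG (?h P + ?h Q) = P + Q"
      by (simp_all add: plus_fun_def V_family_add clebsch_gordan_add h)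
  qed
  moreover have "?h (smult [:c:] P) = (\<lambda>i. smult c (?h P i))" if "P \<in> A" for P c
  proof (rule hI)
    have "P \<in> V2 (Suc m1) (Suc m2)" using that A by auto
    then show "(\<lambda>i. smult c (?h P i)) \<in> ?D" "?CG (\<lambda>i. smult c (?h P i)) = smult [:c:] P"
      by (simp_all only: V_family_smult clebsch_gordan_smult h)
  qed
  ultimately show ?thesis unfolding iso_rat_def by blast
qed

theorem proposition3p35:
  fixes k1 k2 :: nat
  assumes "even k1" "k1 \<ge> 2" "even k2" "k2 \<ge> 2"
  shows "V2_ID k1 k2 \<cong>\<^sub>\<rat> direct_sum {0..min k1 k2 - 2} (\<lambda>i. W (k1 + k2 - 2 - 2 * i)) \<and>
    (\<forall>\<epsilon>\<in>{1, -1}. V2_ID k1 k2 \<inter> V2_sign k1 k2 \<epsilon> \<cong>\<^sub>\<rat>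
       direct_sum {0..min k1 k2 - 2} (\<lambda>i. W_sign (k1 + k2 - 2 - 2 * i) ((-1) ^ i * \<epsilon>)))"
proof -
  \<comment> \<open>Passing from weights to dimensions turns the last index
    \<open>min k1 k2 - 2\<close> into \<open>min m1 m2 - 1\<close>.\<close>
  define m1 m2 where "m1 = k1 - 1" and "m2 = k2 - 1"
  then have k: "k1 = Suc m1" "k2 = Suc m2" "m1 > 0" "m2 > 0" using assms by auto
  have I: "{0..min k1 k2 - 2} = {..<min m1 m2}" and w: "k1 + k2 - 2 - 2 * i = m1 + m2 - 2 * i" for i
    using k by auto
  have W_le: "direct_sum {..<min m1 m2} (\<lambda>i. W (m1 + m2 - 2 * i)) \<subseteq> V_family m1 m2"
    by (auto simp: V_family_def direct_sum_def W_def)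
  have W_sign: "f \<in> direct_sum {..<min m1 m2} (\<lambda>i. W_sign (m1 + m2 - 2 * i) ((-1) ^ i * \<epsilon>)) \<longleftrightarrow>
      f \<in> direct_sum {..<min m1 m2} (\<lambda>i. W (m1 + m2 - 2 * i)) \<and>
      (\<forall>i. pcompose (f i) [:0, -1:] = smult ((-1) ^ i * \<epsilon>) (f i))" for f \<epsilon>
  proof -
    \<comment> \<open>The zero polynomial satisfies every parity condition, so the condition may be
      imposed at all indices, including those outside the range.\<close>
    have "pcompose (f i) [:0, -1:] = smult ((-1) ^ i * \<epsilon>) (f i)" if "f i = 0" for i
      using that by simp
    then show ?thesis
      unfolding direct_sum_iff[OF finite_lessThan] W_sign_def by blast
  qed
  have ID_le: "V2_ID (Suc m1) (Suc m2) \<subseteq> V2 (Suc m1) (Suc m2)"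
    by (auto simp: V2_ID_def)
  show ?thesis
    unfolding I w unfolding k(1,2)
  proof (intro conjI ballI)
    show "V2_ID (Suc m1) (Suc m2) \<cong>\<^sub>\<rat> direct_sum {..<min m1 m2} (\<lambda>i. W (m1 + m2 - 2 * i))"
      using ID_le W_le clebsch_gordan_in_V2_ID_iff by (rule iso_ratI)
    fix \<epsilon> :: rat
    show "V2_ID (Suc m1) (Suc m2) \<inter> V2_sign (Suc m1) (Suc m2) \<epsilon> \<cong>\<^sub>\<rat>
        direct_sum {..<min m1 m2} (\<lambda>i. W_sign (m1 + m2 - 2 * i) ((-1) ^ i * \<epsilon>))"
    proof (rule iso_ratI)
      show "clebsch_gordan m1 m2 f \<in> V2_ID (Suc m1) (Suc m2) \<inter> V2_sign (Suc m1) (Suc m2) \<epsilon> \<longleftrightarrow>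
          f \<in> direct_sum {..<min m1 m2} (\<lambda>i. W_sign (m1 + m2 - 2 * i) ((-1) ^ i * \<epsilon>))"
        if "f \<in> V_family m1 m2" for f
        unfolding Int_iff clebsch_gordan_in_V2_ID_iff[OF that] clebsch_gordan_in_V2_sign_iff[OF that] W_sign ..
    qed (use ID_le W_le W_sign in blast)+
  qed
qed

end
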